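(* Let $C\subset\mathbb R^d$ be a nonempty compact set and let $\{\varphi_i\}_{i=1}^{\kappa}$ be a similitude iterated function system on $\mathbb R^d$ satisfying the condensation open set condition with condensation $C$. If $E$ is the associated self-similar set and $E_C$ is the inhomogeneous self-similar set with condensation $C$, then $$\underline{\dim}_{\mathrm A}(E_C)=\underline{\dim}_{\mathrm A}(C).$$
   Context: A similitude iterated function system (IFS) is a finite collection $\{\varphi_i\}_{i=1}^\kappa$ of contractive similitudes of $\mathbb R^d$. The associated self-similar set is the unique nonempty compact set $E\subset\mathbb R^d$ with $E=\bigcup_{i=1}^\kappa\varphi_i(E)$. For a compact set $C\subset\mathbb R^d$, the inhomogeneous self-similar set with condensation $C$ is the unique nonempty compact set $E_C\subset\mathbb R^d$ with $E_C=\bigcup_{i=1}^\kappa\varphi_i(E_C)\cup C$. Condensation open set condition (COSC) with condensation $C$: there exists a nonempty open set $U\subset\mathbb R^d$ such that $C\subset U\setminus\bigcup_i\overline{\varphi_i(U)}$, $\varphi_i(U)\subset U$ for all $i$, and $\varphi_i(U)\cap\varphi_j(U)=\emptyset$ whenever $i\ne j$. Lower dimension $\underline{\dim}_{\mathrm A}(A)$ of a set $A\subset\mathbb R^d$, regarded as a metric space with the restricted metric: the supremum of all $t\ge0$ for which there is a constant $c>0$ such that, for all $x\in A$ and $0<r<R<\operatorname{diam}(A)$, at least $c(r/R)^{-t}$ balls of radius $r$ are needed to cover the closed ball $B(x,R)$ of $A$. (For a one-point set the restriction $R<\operatorname{diam}(A)$ is removed, so its lower dimension is $0$.) *)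

theory Defs
  imports "HOL-Analysis.Analysis"
begin

definition contractive_similitude :: "('a::euclidean_space \<Rightarrow> 'a) \<Rightarrow> bool" where
  "contractive_similitude f \<longleftrightarrow>
     (\<exists>\<rho>. 0 < \<rho> \<and> \<rho> < 1 \<and> (\<forall>x y. dist (f x) (f y) = \<rho> * dist x y))"

definition similitude_ifs :: "nat \<Rightarrow> (nat \<Rightarrow> 'a::euclidean_space \<Rightarrow> 'a) \<Rightarrow> bool" where
  "similitude_ifs \<kappa> \<phi> \<longleftrightarrow> 1 \<le> \<kappa> \<and> (\<forall>i\<in>{1..\<kappa>}. contractive_similitude (\<phi> i))"

definition is_self_similar_set ::
    "nat \<Rightarrow> (nat \<Rightarrow> 'a::euclidean_space \<Rightarrow> 'a) \<Rightarrow> 'a set \<Rightarrow> bool" where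
  "is_self_similar_set \<kappa> \<phi> E \<longleftrightarrow>
     E \<noteq> {} \<and> compact E \<and> E = (\<Union>i\<in>{1..\<kappa>}. \<phi> i ` E)"

definition is_inhomogeneous_self_similar_set ::
    "nat \<Rightarrow> (nat \<Rightarrow> 'a::euclidean_space \<Rightarrow> 'a) \<Rightarrow> 'a set \<Rightarrow> 'a set \<Rightarrow> bool" where
  "is_inhomogeneous_self_similar_set \<kappa> \<phi> C E\<^sub>C \<longleftrightarrow>
     E\<^sub>C \<noteq> {} \<and> compact E\<^sub>C \<and> E\<^sub>C = (\<Union>i\<in>{1..\<kappa>}. \<phi> i ` E\<^sub>C) \<union> C"

definition condensation_open_set_condition ::
    "nat \<Rightarrow> (nat \<Rightarrow> 'a::euclidean_space \<Rightarrow> 'a) \<Rightarrow> 'a set \<Rightarrow> bool" where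
  "condensation_open_set_condition \<kappa> \<phi> C \<longleftrightarrow>
     (\<exists>U. open U \<and> U \<noteq> {} \<and>
        C \<subseteq> U - (\<Union>i\<in>{1..\<kappa>}. closure (\<phi> i ` U)) \<and>
        (\<forall>i\<in>{1..\<kappa>}. \<phi> i ` U \<subseteq> U) \<and>
        (\<forall>i\<in>{1..\<kappa>}. \<forall>j\<in>{1..\<kappa>}. i \<noteq> j \<longrightarrow> \<phi> i ` U \<inter> \<phi> j ` U = {}))"

text \<open>
  \<open>A\<close> is regarded as a metric space in its own right, so the covering balls are closed balls
  centred at points of \<open>A\<close>; \<open>F\<close> is their set of centres. Infinite covers need not be
  mentioned, as they exceed every real bound. The restriction on \<open>R\<close> is \<open>R < diam A\<close>:
  it is dropped for one-point sets by convention, and for unbounded \<open>A\<close> because then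
  \<open>diam A\<close> is infinite while \<^const>\<open>diameter\<close> is real-valued and meaningless.
\<close>

definition lower_homogeneous :: "'a::metric_space set \<Rightarrow> real \<Rightarrow> bool" where
  "lower_homogeneous A t \<longleftrightarrow>
     (\<exists>c>0. \<forall>x\<in>A. \<forall>r R.
        0 < r \<and> r < R \<and> (bounded A \<and> \<not> is_singleton A \<longrightarrow> R < diameter A) \<longrightarrow>
        (\<forall>F. finite F \<and> F \<subseteq> A \<and> A \<inter> cball x R \<subseteq> (\<Union>y\<in>F. cball y r) \<longrightarrow>
           c * (r / R) powr (- t) \<le> real (card F)))"

definition lower_dimension :: "'a::metric_space set \<Rightarrow> ereal" where
  "lower_dimension A = (SUP t\<in>{t. 0 \<le> t \<and> lower_homogeneous A t}. ereal t)"

end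

theory Submission
  imports Defs
begin

text \<open>
  The condensation open set condition forces \<open>E\<^sub>C \<subseteq> closure U\<close>, so \<open>C\<close> has positive distance to the
  rest of \<open>E\<^sub>C\<close>; hence small balls of \<open>E\<^sub>C\<close> centred in \<open>C\<close> are balls of \<open>C\<close>, and homogeneity passes
  from \<open>E\<^sub>C\<close> to \<open>C\<close>, since only small scales matter for bounded sets.
  Conversely, let \<open>x \<in> E\<^sub>C\<close> and a scale \<open>R\<close> be given. Unless \<open>x \<in> C\<close>, the point \<open>x\<close> lies in some
  \<open>\<phi> i ` E\<^sub>C\<close>, and pulling back by \<open>\<phi> i\<close> enlarges \<open>R\<close> by a definite factor. After finitely many
  steps one either lands in \<open>C\<close> or reaches a scale comparable to the diameter of \<open>E\<^sub>C\<close>, where the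
  ball contains all of \<open>C\<close>. In both cases the homogeneity of \<open>C\<close> applies.
\<close>

section \<open>Covering bounds at small scales\<close>

text \<open>Keeping the constant \<open>c\<close> and the cutoff \<open>M\<close> explicit allows
  bounds of different sets to be compared and treats one-point sets like all others, with no
  reference to the diameter.\<close>

definition homogeneous_below :: "'a::metric_space set \<Rightarrow> real \<Rightarrow> real \<Rightarrow> real \<Rightarrow> bool" where
  "homogeneous_below A t c M \<longleftrightarrow>
     (\<forall>x\<in>A. \<forall>r R F. 0 < r \<and> r < R \<and> R < M \<and> finite F \<and> F \<subseteq> A \<and>
        A \<inter> cball x R \<subseteq> (\<Union>y\<in>F. cball y r) \<longrightarrow> c * (r / R) powr (- t) \<le> real (card F))"

text \<open>Covering balls that miss \<open>B\<close> are discarded; each other one is recentred at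
  a point of \<open>B\<close> inside it, which costs a factor 2 in the radius by the triangle
  inequality.\<close>

lemma finite_cover_centres_inside:
  fixes B :: "'a::metric_space set"
  assumes "finite F" "B \<subseteq> (\<Union>y\<in>F. cball y r)"
  obtains G where "finite G" "G \<subseteq> B" "card G \<le> card F" "B \<subseteq> (\<Union>y\<in>G. cball y (2 * r))"
proof -
  define H where "H = {y \<in> F. B \<inter> cball y r \<noteq> {}}"
  have "\<forall>y\<in>H. \<exists>z. z \<in> B \<inter> cball y r" unfolding H_def by auto
  then obtain g where g: "\<And>y. y \<in> H \<Longrightarrow> g y \<in> B \<inter> cball y r" by metis
  have fH: "finite H" "card H \<le> card F"
    unfolding H_def using assms(1) by (auto intro: card_mono)
  show thesis
  proof (rule that[of "g ` H"])
    show "finite (g ` H)" using fH by simp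
    show "g ` H \<subseteq> B" using g by auto
    show "card (g ` H) \<le> card F" using card_image_le[OF fH(1)] fH(2) le_trans by blast
    show "B \<subseteq> (\<Union>y\<in>g ` H. cball y (2 * r))"
    proof
      fix z assume z: "z \<in> B"
      then obtain y where y: "y \<in> F" "z \<in> cball y r" using assms(2) by auto
      then have yH: "y \<in> H" unfolding H_def using z by auto
      have "dist (g y) z \<le> dist y (g y) + dist y z" by (metis dist_commute dist_triangle)
      also have "\<dots> \<le> 2 * r" using g[OF yH] y(2) by auto
      finally show "z \<in> (\<Union>y\<in>g ` H. cball y (2 * r))" using yH by auto
    qed
  qed
qed

text \<open>Shrinking \<open>R\<close> by a fixed factor brings every scale below \<open>M\<close>
  under \<delta> and changes \<open>r / R\<close> only by a constant factor. The bound obtained also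
  allows centres outside \<open>A\<close>, as occur when a cover of a larger set is restricted to
  \<open>A\<close>.\<close>

lemma homogeneous_below_rescale:
  fixes A :: "'a::metric_space set"
  assumes hom: "homogeneous_below A t c \<delta>" and c: "c > 0" and d: "\<delta> > 0" and t: "t \<ge> 0"
  obtains c' where "c' > 0"
    "\<And>x r R F. \<lbrakk>x \<in> A; 0 < r; r < R; R < M; finite F; A \<inter> cball x R \<subseteq> (\<Union>y\<in>F. cball y r)\<rbrakk>
       \<Longrightarrow> c' * (r / R) powr (- t) \<le> real (card F)"
proof -
  \<comment> \<open>\<open>max 1 M\<close> keeps the quotient positive for every real
    \<open>M\<close>; \<open>min 1\<close> ensures that the shrunken ball stays inside the original
    one.\<close>
  define \<theta> where "\<theta> = min 1 (\<delta> / max 1 M)"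
  have th: "0 < \<theta>" "\<theta> \<le> 1" unfolding \<theta>_def using d by auto
  have thM: "\<theta> * R < \<delta>" if "R < M" "0 < R" for R
  proof -
    have "\<theta> * R \<le> \<delta> / max 1 M * R"
      unfolding \<theta>_def using that by (intro mult_right_mono) auto
    also have "\<dots> < \<delta> / max 1 M * max 1 M"
      using that d by (intro mult_strict_left_mono) auto
    finally show ?thesis by simp
  qed
  \<comment> \<open>The power absorbs both the doubling of \<open>r\<close> and the shrinking of
    \<open>R\<close>. The minimum with 1 serves the case where the doubled radius is at least the
    shrunken one: there the only bound used is that the cover is nonempty.\<close>
  define c' where "c' = min c 1 * (2 / \<theta>) powr (- t)"
  show thesis
  proof (rule that[of c'])
    show "c' > 0" unfolding c'_def using c th by auto
    fix x r R F
    assume x: "x \<in> A" and r: "0 < r" "r < R" and R: "R < M" and F: "finite F"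
      and cov: "A \<inter> cball x R \<subseteq> (\<Union>y\<in>F. cball y r)"
    have R0: "R > 0" using r by simp
    have eq: "(2 * r / (\<theta> * R)) powr (- t) = (2 / \<theta>) powr (- t) * (r / R) powr (- t)"
      using th r R0 by (subst powr_mult[symmetric]) (auto simp: field_simps)
    show "c' * (r / R) powr (- t) \<le> real (card F)"
    proof (cases "2 * r < \<theta> * R")
      case True
      have thR: "\<theta> * R \<le> R" using th R0 by (simp add: mult_le_cancel_right1)
      have "A \<inter> cball x (\<theta> * R) \<subseteq> A \<inter> cball x R" using thR by auto
      then have "A \<inter> cball x (\<theta> * R) \<subseteq> (\<Union>y\<in>F. cball y r)" using cov by blast
      from finite_cover_centres_inside[OF F this]
      obtain G where G: "finite G" "G \<subseteq> A \<inter> cball x (\<theta> * R)" "card G \<le> card F"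
        "A \<inter> cball x (\<theta> * R) \<subseteq> (\<Union>y\<in>G. cball y (2 * r))" .
      have "c' * (r / R) powr (- t) \<le> c * (2 * r / (\<theta> * R)) powr (- t)"
        unfolding eq c'_def by (simp add: mult.assoc mult_right_mono)
      also have "\<dots> \<le> real (card G)"
        using hom[unfolded homogeneous_below_def, rule_format, OF x,
            of "2 * r" "\<theta> * R" G] G r True thM[OF R R0] by auto
      finally show ?thesis using G(3) by linarith
    next
      case False
      have ge1: "1 \<le> 2 * r / (\<theta> * R)" using False th R0 by (simp add: field_simps)
      have "(2 * r / (\<theta> * R)) powr (- t) \<le> (2 * r / (\<theta> * R)) powr 0"
        using ge1 t by (intro powr_mono) auto
      then have "(2 * r / (\<theta> * R)) powr (- t) \<le> 1"
        using ge1 r th R0 by simp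
      then have "c' * (r / R) powr (- t) \<le> 1 * 1"
        unfolding c'_def mult.assoc eq[symmetric] using c by (intro mult_mono) auto
      moreover have "F \<noteq> {}" using x cov R0 by auto
      then have "card F \<ge> 1" using F by (simp add: Suc_le_eq card_gt_0_iff)
      ultimately show ?thesis by linarith
    qed
  qed
qed

section \<open>Lower homogeneity as a small-scale property\<close>

text \<open>One ball covers a point at every radius, so letting \<open>r / R\<close> tend to 0
  contradicts a positive exponent.\<close>

lemma singleton_homogeneous_below_imp_zero:
  assumes hom: "homogeneous_below {a} t c \<delta>" and c: "c > 0" and d: "\<delta> > 0" and t: "t \<ge> 0"
  shows "t = 0"
proof (rule ccontr)
  assume "t \<noteq> 0"
  then have t: "t > 0" using t by simp
  \<comment> \<open>The ratio \<open>r / R\<close> is chosen so that \<open>s powr t\<close> is at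
    most \<open>c / 2\<close>, whereas the one-ball cover would force it to be at least
    \<open>c\<close>.\<close>
  define s where "s = min (1/2) ((c/2) powr (1/t))"
  have s: "0 < s" "s < 1" unfolding s_def using c by auto
  have "s powr t \<le> ((c/2) powr (1/t)) powr t"
    using s t by (intro powr_mono2) (auto simp: s_def)
  also have "\<dots> = c / 2" using c t by (simp add: powr_powr)
  finally have st: "s powr t \<le> c / 2" .
  have "c * (s * (\<delta>/2) / (\<delta>/2)) powr (- t) \<le> real (card {a})"
    using s d
    by (intro hom[unfolded homogeneous_below_def, rule_format]) auto
  then have "c * s powr (- t) \<le> 1" using d by simp
  then have "c \<le> s powr t" using s by (simp add: powr_minus field_simps)
  then show False using st c by linarith
qed

lemma lower_homogeneous_zero: "lower_homogeneous A 0"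
  unfolding lower_homogeneous_def
proof (intro exI[of _ "1::real"] conjI ballI allI impI)
  fix x r R F
  assume "x \<in> A" and rR: "0 < r \<and> r < R \<and> (bounded A \<and> \<not> is_singleton A \<longrightarrow> R < diameter A)"
    and F: "finite F \<and> F \<subseteq> A \<and> A \<inter> cball x R \<subseteq> (\<Union>y\<in>F. cball y r)"
  then have "F \<noteq> {}" by auto
  then have "card F \<ge> 1" using F by (simp add: Suc_le_eq card_gt_0_iff)
  then show "1 * (r / R) powr - 0 \<le> real (card F)" using rR by simp
qed simp

lemma diameter_pos:
  assumes "bounded A" "A \<noteq> {}" "\<not> is_singleton A"
  shows "diameter A > 0"
proof -
  obtain x y where "x \<in> A" "y \<in> A" "x \<noteq> y"
    using assms by (metis is_singletonI')
  moreover from this have "dist x y \<le> diameter A" using diameter_bounded_bound assms(1) by blast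
  ultimately show ?thesis by (meson less_le_trans zero_less_dist_iff)
qed

lemma lower_homogeneous_imp_below:
  assumes "lower_homogeneous A t" "bounded A" "A \<noteq> {}"
  obtains c \<delta> where "c > 0" "\<delta> > 0" "homogeneous_below A t c \<delta>"
proof -
  \<comment> \<open>For one-point sets the definition leaves \<open>R\<close> unrestricted, so 1 is
    an arbitrary positive choice.\<close>
  define \<delta> where "\<delta> = (if is_singleton A then 1 else diameter A)"
  have d: "\<delta> > 0" unfolding \<delta>_def using diameter_pos assms by auto
  obtain c where c: "c > 0" and bound:
    "\<forall>x\<in>A. \<forall>r R.
        0 < r \<and> r < R \<and> (bounded A \<and> \<not> is_singleton A \<longrightarrow> R < diameter A) \<longrightarrow>
        (\<forall>F. finite F \<and> F \<subseteq> A \<and> A \<inter> cball x R \<subseteq> (\<Union>y\<in>F. cball y r) \<longrightarrow>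
           c * (r / R) powr (- t) \<le> real (card F))"
    using assms(1) unfolding lower_homogeneous_def by auto
  have "homogeneous_below A t c \<delta>"
    using bound unfolding homogeneous_below_def \<delta>_def by auto
  with c d show thesis by (rule that)
qed

text \<open>Rescaling with \<open>M\<close> equal to the diameter reaches all admissible scales. A
  one-point set has no such bound on \<open>R\<close>, but there \<open>t = 0\<close> is
  forced.\<close>

lemma below_imp_lower_homogeneous:
  assumes hom: "homogeneous_below A t c \<delta>" and c: "c > 0" and d: "\<delta> > 0" and t: "t \<ge> 0"
    and A: "bounded A" "A \<noteq> {}"
  shows "lower_homogeneous A t"
proof (cases "is_singleton A")
  case True
  then obtain a where "A = {a}" by (auto elim: is_singletonE)
  then have "t = 0" using singleton_homogeneous_below_imp_zero hom c d t by blast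
  then show ?thesis using lower_homogeneous_zero by simp
next
  case False
  obtain c' where c': "c' > 0"
    "\<And>x r R F. \<lbrakk>x \<in> A; 0 < r; r < R; R < diameter A; finite F;
       A \<inter> cball x R \<subseteq> (\<Union>y\<in>F. cball y r)\<rbrakk> \<Longrightarrow> c' * (r / R) powr (- t) \<le> real (card F)"
    using homogeneous_below_rescale[OF hom c d t] by blast
  then show ?thesis unfolding lower_homogeneous_def using A(1) False
    by (intro exI[of _ c']) auto
qed

section \<open>Similitudes and separation of the condensation set\<close>

text \<open>After dividing by the ratio and translating, the map is an isometry fixing 0, hence an
  orthogonal transformation and onto. Surjectivity later permits pulling back arbitrary ball
  centres.\<close>

lemma similitude_bij:
  fixes f :: "'a::euclidean_space \<Rightarrow> 'a"
  assumes "\<rho> > 0" and f: "\<And>x y. dist (f x) (f y) = \<rho> * dist x y"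
  shows "bij f"
proof -
  define g where "g x = (1/\<rho>) *\<^sub>R (f x - f 0)" for x
  have "dist (g x) (g y) = dist x y" for x y
  proof -
    have "g x - g y = (1/\<rho>) *\<^sub>R (f x - f y)" unfolding g_def by (simp add: algebra_simps)
    then show ?thesis using f[of x y] assms(1) by (simp add: dist_norm)
  qed
  then have "orthogonal_transformation g"
    unfolding orthogonal_transformation_isometry by (simp add: g_def)
  then have surj: "surj g" by (rule orthogonal_transformation_surj)
  have "surj f"
    unfolding surj_def
  proof
    fix y
    obtain x where "(1/\<rho>) *\<^sub>R (y - f 0) = g x" using surj by (meson surjD)
    then show "\<exists>x. y = f x" unfolding g_def using assms(1) by auto
  qed
  moreover have "inj f"
    using f assms(1) by (metis dist_eq_0_iff injI mult_eq_0_iff less_irrefl)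
  ultimately show ?thesis by (rule bijI[rotated])
qed

lemma similitude_image_cball:
  fixes f :: "'a::euclidean_space \<Rightarrow> 'a"
  assumes "\<rho> > 0" and "\<And>x y. dist (f x) (f y) = \<rho> * dist x y"
  shows "f z \<in> cball (f x) (\<rho> * R) \<longleftrightarrow> z \<in> cball x R"
  using assms by simp

text \<open>Take a point \<open>m\<close> of \<open>K\<close> farthest from \<open>U\<close>. If it
  is the image of some \<open>z\<close> in \<open>K\<close>, contraction makes its distance to
  \<open>U\<close> at most \<rho> times that of \<open>z\<close>, hence at most \<rho> times its
  own, so it vanishes.\<close>

lemma invariant_set_subset_closure:
  fixes K :: "'a::euclidean_space set"
  assumes K: "compact K" "K \<subseteq> (\<Union>i\<in>I. \<phi> i ` K) \<union> C"
    and C: "C \<subseteq> U" and U: "U \<noteq> {}" "\<And>i. i \<in> I \<Longrightarrow> \<phi> i ` U \<subseteq> U"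
    and sim: "\<And>i. i \<in> I \<Longrightarrow> contractive_similitude (\<phi> i)"
  shows "K \<subseteq> closure U"
proof (cases "K = {}")
  case False
  have "continuous_on K (\<lambda>x. infdist x U)" by (intro continuous_intros)
  then obtain m where m: "m \<in> K" "\<And>y. y \<in> K \<Longrightarrow> infdist y U \<le> infdist m U"
    using continuous_attains_sup[OF K(1) False] by blast
  have "infdist m U \<le> 0"
  proof (cases "m \<in> C")
    case True
    then show ?thesis using C by (metis infdist_zero subsetD order_refl)
  next
    case False
    then obtain i z where i: "i \<in> I" "z \<in> K" "m = \<phi> i z" using m(1) K(2) by auto
    obtain \<rho> where rho: "0 < \<rho>" "\<rho> < 1" "\<And>x y. dist (\<phi> i x) (\<phi> i y) = \<rho> * dist x y"
      using sim[OF i(1)] unfolding contractive_similitude_def by auto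
    have "infdist m U / \<rho> \<le> dist z u" if "u \<in> U" for u
    proof -
      have "infdist m U \<le> dist m (\<phi> i u)" using U(2)[OF i(1)] that by (intro infdist_le) auto
      then show ?thesis using rho i(3) by (simp add: field_simps)
    qed
    then have "infdist m U / \<rho> \<le> infdist z U"
      unfolding infdist_def[of z U] using U(1) by (auto intro!: cINF_greatest)
    also have "\<dots> \<le> infdist m U" using m i by blast
    finally have "infdist m U * (1 - \<rho>) \<le> 0" using rho by (simp add: field_simps)
    then show ?thesis using rho by (simp add: mult_le_0_iff)
  qed
  then have "infdist y U = 0" if "y \<in> K" for y
    using m(2)[OF that] infdist_nonneg[of y U] by linarith
  then show ?thesis using in_closure_iff_infdist_zero[OF U(1)] by blast
qed simp

lemma condensation_set_separated:
  assumes C: "compact C" and ifs: "similitude_ifs \<kappa> \<phi>"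
    and cosc: "condensation_open_set_condition \<kappa> \<phi> C"
    and K: "is_inhomogeneous_self_similar_set \<kappa> \<phi> C K"
  obtains \<delta> where "\<delta> > 0" "\<And>x y. \<lbrakk>x \<in> C; y \<in> K; dist x y < \<delta>\<rbrakk> \<Longrightarrow> y \<in> C"
proof -
  let ?J = "\<Union>i\<in>{1..\<kappa>}. \<phi> i ` K"
  have sim: "\<And>i. i \<in> {1..\<kappa>} \<Longrightarrow> contractive_similitude (\<phi> i)"
    using ifs unfolding similitude_ifs_def by auto
  have cont: "continuous_on S (\<phi> i)" if i: "i \<in> {1..\<kappa>}" for i S
  proof -
    obtain \<rho> where "0 < \<rho>" "\<And>x y. dist (\<phi> i x) (\<phi> i y) = \<rho> * dist x y"
      using sim[OF i] unfolding contractive_similitude_def by auto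
    then have "\<rho>-lipschitz_on S (\<phi> i)" by (auto intro: lipschitz_onI)
    then show ?thesis by (rule lipschitz_on_continuous_on)
  qed
  obtain U where U: "U \<noteq> {}" "C \<subseteq> U - (\<Union>i\<in>{1..\<kappa>}. closure (\<phi> i ` U))"
    "\<forall>i\<in>{1..\<kappa>}. \<phi> i ` U \<subseteq> U"
    using cosc unfolding condensation_open_set_condition_def by auto
  have KK: "compact K" "K = ?J \<union> C"
    using K unfolding is_inhomogeneous_self_similar_set_def by auto
  have KU: "K \<subseteq> closure U"
    by (rule invariant_set_subset_closure[where I = "{1..\<kappa>}" and \<phi> = \<phi> and C = C])
      (use KK U sim in auto)
  have "\<phi> i ` K \<subseteq> closure (\<phi> i ` U)" if "i \<in> {1..\<kappa>}" for i
  proof -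
    have "\<phi> i ` closure U \<subseteq> closure (\<phi> i ` U)"
      by (rule image_closure_subset[OF cont[OF that]]) (simp_all add: closure_subset)
    then show ?thesis using KU by blast
  qed
  then have disj: "C \<inter> ?J = {}" using U(2) by blast
  have "compact ?J"
    using KK(1) cont by (intro compact_UN) (auto intro: compact_continuous_image)
  then have "closed ?J" by (rule compact_imp_closed)
  from separate_compact_closed[OF C this disj]
  obtain d where "d > 0" "\<forall>x\<in>C. \<forall>y\<in>?J. d \<le> dist x y" by auto
  moreover have "y \<in> ?J \<or> y \<in> C" if "y \<in> K" for y using that KK(2) by blast
  ultimately show thesis using that[of d] by (meson not_le)
qed

section \<open>Transfer of covering bounds from \<open>C\<close> to the inhomogeneous set\<close>

text \<open>Pulling back by a similitude preserves \<open>r / R\<close> and does not increase the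
  number of balls, so one constant survives any number of pull-backs.\<close>

lemma inhomogeneous_self_similar_covering_bound:
  fixes K C :: "'a::euclidean_space set"
  assumes ifs: "similitude_ifs \<kappa> \<phi>"
    and K: "is_inhomogeneous_self_similar_set \<kappa> \<phi> C K"
    and C: "C \<noteq> {}" and D: "diameter K > 0"
    and hom: "homogeneous_below C t c \<delta>" and c: "c > 0" and d: "\<delta> > 0" and t: "t \<ge> 0"
  obtains c' where "c' > 0" "homogeneous_below K t c' (diameter K)"
proof -
  let ?I = "{1..\<kappa>}" and ?D = "diameter K"
  have KK: "compact K" "K = (\<Union>i\<in>?I. \<phi> i ` K) \<union> C"
    using K unfolding is_inhomogeneous_self_similar_set_def by auto
  have "\<forall>i\<in>?I. \<exists>\<rho>. 0 < \<rho> \<and> \<rho> < 1 \<and> (\<forall>x y. dist (\<phi> i x) (\<phi> i y) = \<rho> * dist x y)"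
    using ifs unfolding similitude_ifs_def contractive_similitude_def by auto
  then obtain \<rho> where rho: "\<And>i. i \<in> ?I \<Longrightarrow> 0 < \<rho> i" "\<And>i. i \<in> ?I \<Longrightarrow> \<rho> i < 1"
    "\<And>i x y. i \<in> ?I \<Longrightarrow> dist (\<phi> i x) (\<phi> i y) = \<rho> i * dist x y" by metis
  have I: "finite (\<rho> ` ?I)" "\<rho> ` ?I \<noteq> {}"
    using ifs unfolding similitude_ifs_def by auto
  define a where "a = Min (\<rho> ` ?I)"
  define b where "b = Max (\<rho> ` ?I)"
  have a: "0 < a" "a < 1" "\<And>i. i \<in> ?I \<Longrightarrow> a \<le> \<rho> i"
    unfolding a_def using I rho by (auto simp: Min_gr_iff Min_less_iff)
  have b: "0 < b" "b < 1" "\<And>i. i \<in> ?I \<Longrightarrow> \<rho> i \<le> b"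
    unfolding b_def using I rho by (auto simp: Max_gr_iff)
  \<comment> \<open>A pull-back from a radius below \<open>?D\<close> may overshoot
    \<open>?D\<close>, but stays below \<open>?D / a\<close> because \<open>a\<close> is the least
    ratio.\<close>
  obtain c' where c': "c' > 0" and bound:
    "\<And>x r R F. \<lbrakk>x \<in> C; 0 < r; r < R; R < ?D / a; finite F;
       C \<inter> cball x R \<subseteq> (\<Union>y\<in>F. cball y r)\<rbrakk> \<Longrightarrow> c' * (r / R) powr (- t) \<le> real (card F)"
    using homogeneous_below_rescale[OF hom c d t] by blast
  \<comment> \<open>Centres are unrestricted here, because preimages of points of \<open>K\<close>
    may lie outside \<open>K\<close>.\<close>
  define P where "P x R \<longleftrightarrow>
      (\<forall>r F. 0 < r \<and> r < R \<and> finite F \<and> K \<inter> cball x R \<subseteq> (\<Union>y\<in>F. cball y r)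
         \<longrightarrow> c' * (r / R) powr (- t) \<le> real (card F))" for x R
  have in_C: "P x R" if "x \<in> C" "R < ?D / a" for x R
  proof -
    have "C \<inter> cball x R \<subseteq> K \<inter> cball x R" using KK(2) by blast
    then show ?thesis unfolding P_def using that bound[of x] by (meson order_trans)
  qed
  \<comment> \<open>At such a radius the ball about \<open>x\<close> contains all of
    \<open>K\<close>, so \<open>x\<close> may be replaced by a point of \<open>C\<close>.\<close>
  have large: "P x R" if "x \<in> K" "?D \<le> R" "R < ?D / a" for x R
  proof -
    obtain x0 where x0: "x0 \<in> C" using C by auto
    have "K \<inter> cball x0 R \<subseteq> K \<inter> cball x R"
    proof
      fix y assume "y \<in> K \<inter> cball x0 R"
      then show "y \<in> K \<inter> cball x R"
        using diameter_bounded_bound[OF compact_imp_bounded[OF KK(1)] that(1), of y] that(2) by auto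
    qed
    then show ?thesis using in_C[OF x0 that(3)] unfolding P_def by (meson order_trans)
  qed
  have pull_back: "P (\<phi> i z) R" if i: "i \<in> ?I" and P: "P z (R / \<rho> i)" for i z R
    unfolding P_def
  proof (intro allI impI, elim conjE)
    fix r F
    assume r: "0 < r" "r < R" and F: "finite F"
      and cov: "K \<inter> cball (\<phi> i z) R \<subseteq> (\<Union>y\<in>F. cball y r)"
    note ri = rho(1)[OF i]
    have bij: "bij (\<phi> i)" using similitude_bij[OF ri rho(3)[OF i]] .
    have card: "card (inv (\<phi> i) ` F) \<le> card F" using F by (rule card_image_le)
    have "K \<inter> cball z (R / \<rho> i) \<subseteq> (\<Union>y\<in>inv (\<phi> i) ` F. cball y (r / \<rho> i))"
    proof
      fix u assume u: "u \<in> K \<inter> cball z (R / \<rho> i)"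
      then have "\<phi> i u \<in> cball (\<phi> i z) R"
        using similitude_image_cball[OF ri rho(3)[OF i], of u z "R / \<rho> i"] ri by simp
      moreover have "\<phi> i u \<in> K" using u i KK(2) by blast
      ultimately obtain y where y: "y \<in> F" "\<phi> i u \<in> cball y r" using cov by blast
      have "\<phi> i (inv (\<phi> i) y) = y" using bij by (simp add: bij_is_surj surj_f_inv_f)
      then have "u \<in> cball (inv (\<phi> i) y) (r / \<rho> i)"
        using similitude_image_cball[OF ri rho(3)[OF i], of u "inv (\<phi> i) y" "r / \<rho> i"] ri y(2)
        by simp
      then show "u \<in> (\<Union>y\<in>inv (\<phi> i) ` F. cball y (r / \<rho> i))" using y(1) by blast
    qed
    then have "c' * ((r / \<rho> i) / (R / \<rho> i)) powr (- t) \<le> real (card (inv (\<phi> i) ` F))"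
      using r F ri divide_strict_right_mono[OF r(2) ri]
      by (intro P[unfolded P_def, rule_format]) auto
    then show "c' * (r / R) powr (- t) \<le> real (card F)" using card ri by simp
  qed
  \<comment> \<open>\<open>n\<close> bounds the number of pull-backs needed to reach radius
    \<open>?D\<close>: each one enlarges \<open>R\<close> by at least the factor
    \<open>1 / b\<close>.\<close>
  have step: "P x R" if "x \<in> K" "?D * b ^ n \<le> R" "R < ?D / a" for n x R
    using that
  proof (induction n arbitrary: x R)
    case 0
    then show ?case using large by simp
  next
    case (Suc n)
    have "x \<in> (\<Union>i\<in>?I. \<phi> i ` K) \<union> C" using Suc.prems(1) KK(2) by (rule subst[rotated])
    then consider "?D \<le> R" | "x \<in> C" | i z where "R < ?D" "i \<in> ?I" "z \<in> K" "x = \<phi> i z"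
      by (cases "?D \<le> R") auto
    then show ?case
    proof cases
      case 1 then show ?thesis using large Suc.prems by blast
    next
      case 2 then show ?thesis using in_C Suc.prems by blast
    next
      case 3
      note ri = rho(1)[OF 3(2)]
      have "?D * b ^ n * \<rho> i \<le> ?D * b ^ n * b"
        using b(3)[OF 3(2)] b(1) D by (intro mult_left_mono) auto
      also have "\<dots> \<le> R" using Suc.prems(2) by (simp add: ac_simps)
      finally have lower: "?D * b ^ n \<le> R / \<rho> i" using ri by (simp add: pos_le_divide_eq)
      have "R / \<rho> i < ?D / \<rho> i" using 3(1) ri by (rule divide_strict_right_mono)
      also have "\<dots> \<le> ?D / a"
        using a(1) a(3)[OF 3(2)] D by (intro divide_left_mono) (auto simp: ri)
      finally have "P z (R / \<rho> i)" using Suc.IH[OF 3(3) lower] by simp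
      then show ?thesis using pull_back[OF 3(2)] 3(4) by simp
    qed
  qed
  have "P x R" if "x \<in> K" "0 < R" "R < ?D" for x R
  proof -
    have "0 < R / ?D" using that D by simp
    \<comment> \<open>\<open>n\<close> may depend on \<open>R\<close>, since \<open>c'\<close> does
      not depend on \<open>n\<close>.\<close>
    then obtain n where "b ^ n < R / ?D" using real_arch_pow_inv b(2) by blast
    then have "?D * b ^ n \<le> R" using D by (simp add: field_simps)
    moreover have "?D \<le> ?D / a" using a D by (simp add: field_simps)
    ultimately show ?thesis using step that by auto
  qed
  then have "homogeneous_below K t c' ?D" unfolding homogeneous_below_def P_def by auto
  then show thesis using that c' by blast
qed

theorem theorem4p2:
  fixes C E E\<^sub>C :: "'a::euclidean_space set"
    and \<phi> :: "nat \<Rightarrow> 'a \<Rightarrow> 'a"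
    and \<kappa> :: nat
  assumes "C \<noteq> {}" and "compact C"
    and "similitude_ifs \<kappa> \<phi>"
    and "condensation_open_set_condition \<kappa> \<phi> C"
    and "is_self_similar_set \<kappa> \<phi> E"
    and "is_inhomogeneous_self_similar_set \<kappa> \<phi> C E\<^sub>C"
  shows "lower_dimension E\<^sub>C = lower_dimension C"
proof -
  have EC: "E\<^sub>C \<noteq> {}" "bounded E\<^sub>C" "C \<subseteq> E\<^sub>C"
    using assms(6) unfolding is_inhomogeneous_self_similar_set_def
    by (auto simp: compact_imp_bounded)
  have bC: "bounded C" using assms(2) by (rule compact_imp_bounded)
  have "lower_homogeneous E\<^sub>C t \<longleftrightarrow> lower_homogeneous C t" if t: "t \<ge> 0" for t
  proof
    assume "lower_homogeneous E\<^sub>C t"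
    then obtain c \<delta> where hom: "c > 0" "\<delta> > 0" "homogeneous_below E\<^sub>C t c \<delta>"
      using lower_homogeneous_imp_below EC by blast
    obtain d where d: "d > 0" "\<And>x y. \<lbrakk>x \<in> C; y \<in> E\<^sub>C; dist x y < d\<rbrakk> \<Longrightarrow> y \<in> C"
      using condensation_set_separated[OF assms(2,3,4,6)] by blast
    have local: "E\<^sub>C \<inter> cball x R = C \<inter> cball x R" if "x \<in> C" "R < d" for x R
      using d(2)[OF that(1)] that EC(3) by auto
    have "homogeneous_below C t c (min \<delta> d)"
      unfolding homogeneous_below_def
    proof (intro ballI allI impI, elim conjE)
      fix x r R F
      assume x: "x \<in> C" and rR: "0 < r" "r < R" "R < min \<delta> d"
        and F: "finite F" "F \<subseteq> C" "C \<inter> cball x R \<subseteq> (\<Union>y\<in>F. cball y r)"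
      have "E\<^sub>C \<inter> cball x R \<subseteq> (\<Union>y\<in>F. cball y r)"
        using local[OF x] rR F(3) by simp
      then show "c * (r / R) powr (- t) \<le> real (card F)"
        using x rR F EC(3) by (intro hom(3)[unfolded homogeneous_below_def, rule_format]) auto
    qed
    then show "lower_homogeneous C t"
      using below_imp_lower_homogeneous hom d(1) t bC assms(1) by (metis min_less_iff_conj)
  next
    assume hC: "lower_homogeneous C t"
    obtain c \<delta> where hom: "c > 0" "\<delta> > 0" "homogeneous_below C t c \<delta>"
      using lower_homogeneous_imp_below[OF hC bC assms(1)] by blast
    show "lower_homogeneous E\<^sub>C t"
    \<comment> \<open>A one-point \<open>C\<close> leaves only \<open>t = 0\<close>; otherwise
      \<open>E\<^sub>C\<close> inherits the positive diameter at which the pull-backs stop.\<close>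
    proof (cases "is_singleton C")
      case True
      then obtain a where "C = {a}" by (auto elim: is_singletonE)
      then have "t = 0" using singleton_homogeneous_below_imp_zero hom t by blast
      then show ?thesis using lower_homogeneous_zero by simp
    next
      case False
      then have "0 < diameter C" using diameter_pos bC assms(1) by blast
      also have "\<dots> \<le> diameter E\<^sub>C" using diameter_subset EC by blast
      finally have D: "0 < diameter E\<^sub>C" .
      obtain c' where "c' > 0" "homogeneous_below E\<^sub>C t c' (diameter E\<^sub>C)"
        using inhomogeneous_self_similar_covering_bound[OF assms(3,6,1) D hom(3,1,2) t] by blast
      then show ?thesis using below_imp_lower_homogeneous D t EC by blast
    qed
  qed
  then have "{t. 0 \<le> t \<and> lower_homogeneous E\<^sub>C t} = {t. 0 \<le> t \<and> lower_homogeneous C t}"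
    by blast
  then show ?thesis unfolding lower_dimension_def by simp
qed

end
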